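(* Let $d\ge 1$ and let finitely many terms be given, indexed by $i$, where term $i$ is a finite nonempty list of vectors $\delta_{i,j}\in\mathbb{Z}^d$. Let $F:\mathbb{Z}^d\to\mathbb{Z}_{\ge 0}$ be defined by $F(0)=1$, $F(y)=0$ whenever $y\ne0$ cannot be written as a finite sum (with repetition) of the vectors $\delta_{i,j}$, and $F(x)=\max_i\sum_j F(x-\delta_{i,j})$ otherwise. Let $t\in\mathbb{Z}^d$. Let $(c,w)$ be an optimal solution of the associated quasiconvex program: $w\cdot t=1$, $c=\inf\{c_v: v\in\mathbb{R}^d,\ v\cdot t=1\}$, and $w$ is a limit point of a sequence $w_\ell$ with $w_\ell\cdot t=1$ and $c_{w_\ell}\to c$. Then $F(n\,t)=O(c^n)$.
   Context: For $v\in\mathbb{R}^d$ and a term $i$: if $v\cdot\delta_{i,j}\le0$ for some $j$, set $c_{v,i}=+\infty$; otherwise $c_{v,i}$ is the unique positive root of $r_{v,i}(c)=1-\sum_j c^{-v\cdot\delta_{i,j}}$. Set $c_v=\max_i c_{v,i}\in(0,+\infty]$. If $c=+\infty$ the conclusion is vacuous. *)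

theory Defs
  imports "HOL-Analysis.Analysis" "HOL-Library.Landau_Symbols"
begin

definition real_vec :: "int ^ 'd \<Rightarrow> real ^ 'd" where
  "real_vec x = (\<chi> k. real_of_int (x $ k))"

text \<open>
  A term is the list of its vectors, so that a vector may occur in it several times.
  A system of terms is a list of terms.
\<close>

type_synonym 'd rec_term = "(int ^ 'd) list"

definition generated :: "('d::finite) rec_term list \<Rightarrow> (int ^ 'd) set" where
  "generated ts = {x. \<exists>xs. set xs \<subseteq> (\<Union>T\<in>set ts. set T) \<and> x = sum_list xs}"

text \<open>
  The recursion need not be well-founded for an arbitrary system of terms, so the
  defining equations are stated as a property of \<^term>\<open>F\<close>. They have exactly one
  solution as soon as some real vector has a positive inner product with every vector
  of every term.
\<close>

definition solves_recurrence :: "('d::finite) rec_term list \<Rightarrow> (int ^ 'd \<Rightarrow> nat) \<Rightarrow> bool" where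
  "solves_recurrence ts F \<longleftrightarrow>
     F 0 = 1 \<and>
     (\<forall>y. y \<noteq> 0 \<and> y \<notin> generated ts \<longrightarrow> F y = 0) \<and>
     (\<forall>x. x \<noteq> 0 \<and> x \<in> generated ts \<longrightarrow>
        F x = Max ((\<lambda>T. \<Sum>\<delta>\<leftarrow>T. F (x - \<delta>)) ` set ts))"

definition char_fun :: "real ^ 'd \<Rightarrow> ('d::finite) rec_term \<Rightarrow> real \<Rightarrow> real" where
  "char_fun v T c = 1 - (\<Sum>\<delta>\<leftarrow>T. c powr (- (v \<bullet> real_vec \<delta>)))"

definition term_cost :: "real ^ 'd \<Rightarrow> ('d::finite) rec_term \<Rightarrow> ereal" where
  "term_cost v T =
     (if \<exists>\<delta>\<in>set T. v \<bullet> real_vec \<delta> \<le> 0 then \<infinity>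
      else ereal (THE c. 0 < c \<and> char_fun v T c = 0))"

definition cost :: "('d::finite) rec_term list \<Rightarrow> real ^ 'd \<Rightarrow> ereal" where
  "cost ts v = Max (term_cost v ` set ts)"

text \<open>
  The infimum need not be attained: \<^term>\<open>w\<close> is only required to be a cluster point of
  a minimizing sequence, and \<^term>\<open>cost ts w\<close> may differ from \<^term>\<open>c\<close>.
\<close>

definition optimal_solution ::
    "('d::finite) rec_term list \<Rightarrow> int ^ 'd \<Rightarrow> ereal \<Rightarrow> real ^ 'd \<Rightarrow> bool" where
  "optimal_solution ts t c w \<longleftrightarrow>
     w \<bullet> real_vec t = 1 \<and>
     c = Inf {cost ts v |v. v \<bullet> real_vec t = 1} \<and>
     (\<exists>u :: nat \<Rightarrow> real ^ 'd.
        (\<forall>l. u l \<bullet> real_vec t = 1) \<and>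
        (\<lambda>l. cost ts (u l)) \<longlonglongrightarrow> c \<and>
        (\<exists>r. strict_mono r \<and> (u \<circ> r) \<longlonglongrightarrow> w))"

end

(* Let v give every vector of every term a positive weight, and let b >= 1 be at least the
   root of each characteristic function. Then F x <= b^(v.x) by induction on v.x: in the
   recurrence the factor b^(v.x) splits off and the remaining sum is at most 1. If moreover
   v.t = 1, this reads F(n t) <= b^n, so F(n t) <= c^n for the infimum c of all such b; the
   limit point w plays no role, and the constant in the O is 1. *)

theory Submission
  imports Defs
begin

lemma powr_neg_sum_list_mono:
  fixes as :: "real list"
  assumes "\<forall>a\<in>set as. 0 < a" "0 < x" "x \<le> y"
  shows "(\<Sum>a\<leftarrow>as. y powr - a) \<le> (\<Sum>a\<leftarrow>as. x powr - a)"
  using assms by (intro sum_list_mono powr_mono2') auto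

lemma powr_neg_sum_list_strict_mono:
  fixes as :: "real list"
  assumes "as \<noteq> []" "\<forall>a\<in>set as. 0 < a" "0 < x" "x < y"
  shows "(\<Sum>a\<leftarrow>as. y powr - a) < (\<Sum>a\<leftarrow>as. x powr - a)"
proof (cases as)
  case (Cons a bs)
  have "y powr - a < x powr - a"
    using assms Cons by (intro powr_less_mono2_neg) auto
  moreover have "(\<Sum>a\<leftarrow>bs. y powr - a) \<le> (\<Sum>a\<leftarrow>bs. x powr - a)"
    using assms Cons by (intro powr_neg_sum_list_mono) auto
  ultimately show ?thesis using Cons by simp
qed (use assms in simp)

lemma powr_neg_sum_list_tendsto_0:
  fixes as :: "real list"
  assumes "\<forall>a\<in>set as. 0 < a"
  shows "((\<lambda>x. \<Sum>a\<leftarrow>as. x powr - a) \<longlongrightarrow> 0) at_top"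
  using assms
proof (induction as)
  case (Cons a as)
  have "((\<lambda>x::real. x powr - a) \<longlongrightarrow> 0) at_top"
    using Cons.prems by (intro tendsto_neg_powr filterlim_ident) auto
  from tendsto_add[OF this Cons.IH] Cons.prems show ?case by simp
qed simp

text \<open>The domain stays away from base 0, where \<open>powr\<close> with a negative exponent is
  not continuous. It still contains the interval on which the root is sought.\<close>

lemma continuous_on_powr_neg_sum_list:
  fixes as :: "real list"
  shows "continuous_on {1..} (\<lambda>x. \<Sum>a\<leftarrow>as. x powr - a)"
  by (induction as) (auto intro!: continuous_intros)

text \<open>At base 1 the sum is the length of the list, hence at least 1, and it tends to 0 as the
  base grows. The intermediate value theorem gives a root in [1, C], and strict antitonicity makes
  it the only positive one, so every positive root is at least 1.\<close>

lemma powr_neg_sum_list_ex1: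
  fixes as :: "real list"
  assumes "as \<noteq> []" "\<forall>a\<in>set as. 0 < a"
  shows "\<exists>!c. 0 < c \<and> (\<Sum>a\<leftarrow>as. c powr - a) = 1"
    and "0 < c \<Longrightarrow> (\<Sum>a\<leftarrow>as. c powr - a) = 1 \<Longrightarrow> 1 \<le> c"
proof -
  let ?g = "\<lambda>c. \<Sum>a\<leftarrow>as. c powr - a"
  have len: "1 \<le> length as" using assms by (cases as) auto
  have one: "?g 1 = length as" by (induction as) auto
  have "eventually (\<lambda>x. ?g x < 1) at_top"
    using powr_neg_sum_list_tendsto_0[OF assms(2)] by (rule order_tendstoD) simp
  then obtain C where "?g C < 1" "1 \<le> C"
    using eventually_happens'[OF _ eventually_conj[OF _ eventually_ge_at_top[of 1]]]
    by (metis (no_types, lifting) trivial_limit_at_top_linorder)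
  then have "\<exists>c\<ge>1. c \<le> C \<and> ?g c = 1"
    using len one by (intro IVT2' continuous_on_subset[OF continuous_on_powr_neg_sum_list]) auto
  then obtain z where "1 \<le> z" "?g z = 1" by blast
  then have z: "0 < z" "?g z = 1" by auto
  have inj: "x = y" if "0 < x" "0 < y" "?g x = 1" "?g y = 1" for x y
    using powr_neg_sum_list_strict_mono[OF assms, of x y]
      powr_neg_sum_list_strict_mono[OF assms, of y x] that
    by (cases x y rule: linorder_cases) auto
  show "\<exists>!c. 0 < c \<and> ?g c = 1" using z inj by blast
  show "0 < c \<Longrightarrow> ?g c = 1 \<Longrightarrow> 1 \<le> c"
    using inj[of c z] z \<open>1 \<le> z\<close> by simp
qed

text \<open>This justifies the definite description in \<open>term_cost\<close>: with positive
  weights the described root exists uniquely, so its defining equation may be used.\<close>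

lemma term_cost_finite:
  fixes T :: "('d::finite) rec_term"
  assumes "T \<noteq> []" "\<forall>\<delta>\<in>set T. 0 < v \<bullet> real_vec \<delta>"
  obtains c where "term_cost v T = ereal c" "1 \<le> c"
    "(\<Sum>\<delta>\<leftarrow>T. c powr - (v \<bullet> real_vec \<delta>)) = 1"
proof -
  define as where "as = map (\<lambda>\<delta>. v \<bullet> real_vec \<delta>) T"
  have as: "as \<noteq> []" "\<forall>a\<in>set as. 0 < a" using assms by (auto simp: as_def)
  have char: "char_fun v T c = 0 \<longleftrightarrow> (\<Sum>a\<leftarrow>as. c powr - a) = 1" for c
    by (auto simp: char_fun_def as_def o_def)
  have "\<exists>!c. 0 < c \<and> char_fun v T c = 0"
    unfolding char by (rule powr_neg_sum_list_ex1[OF as])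
  then have root: "0 < (THE c. 0 < c \<and> char_fun v T c = 0)"
      "char_fun v T (THE c. 0 < c \<and> char_fun v T c = 0) = 0"
    by (metis (mono_tags, lifting) theI')+
  show thesis
  proof
    show "term_cost v T = ereal (THE c. 0 < c \<and> char_fun v T c = 0)"
      using assms by (force simp: term_cost_def)
    show "1 \<le> (THE c. 0 < c \<and> char_fun v T c = 0)"
      using powr_neg_sum_list_ex1(2)[OF as] root by (simp add: char)
    show "(\<Sum>\<delta>\<leftarrow>T. (THE c. 0 < c \<and> char_fun v T c = 0) powr - (v \<bullet> real_vec \<delta>)) = 1"
      using root(2) by (simp add: char_fun_def)
  qed
qed

lemma term_cost_ge_1: "T \<noteq> [] \<Longrightarrow> 1 \<le> term_cost v T"
proof (cases "\<exists>\<delta>\<in>set T. v \<bullet> real_vec \<delta> \<le> 0")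
  case False
  assume "T \<noteq> []"
  then obtain c where "term_cost v T = ereal c" "1 \<le> c"
    using False by (meson not_le term_cost_finite)
  then show ?thesis by simp
qed (simp add: term_cost_def)

lemma term_cost_le_cost: "T \<in> set ts \<Longrightarrow> term_cost v T \<le> cost ts v"
  by (simp add: cost_def)

text \<open>This keeps the infimum of the costs away from minus infinity and makes every real upper
  bound of a cost a positive base.\<close>

lemma cost_ge_1:
  assumes "ts \<noteq> []" "\<forall>T\<in>set ts. T \<noteq> []"
  shows "1 \<le> cost ts v"
  using assms term_cost_ge_1 term_cost_le_cost by (metis hd_in_set order_trans)

lemma inner_pos_if_cost_finite:
  assumes "cost ts v < \<infinity>" "T \<in> set ts" "\<delta> \<in> set T"
  shows "0 < v \<bullet> real_vec \<delta>"
proof (rule ccontr)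
  assume "\<not> 0 < v \<bullet> real_vec \<delta>"
  then have "term_cost v T = \<infinity>"
    using assms by (force simp: term_cost_def)
  then show False using term_cost_le_cost[OF assms(2), of v] assms(1) by simp
qed

text \<open>The sum equals 1 at the root belonging to \<open>T\<close>, which is at most
  \<open>b\<close>, and it can only decrease as the base grows.\<close>

lemma powr_neg_sum_list_le_1_if_cost_le:
  assumes "cost ts v \<le> ereal b" "T \<in> set ts" "T \<noteq> []"
  shows "(\<Sum>\<delta>\<leftarrow>T. b powr - (v \<bullet> real_vec \<delta>)) \<le> 1"
proof -
  have "cost ts v < \<infinity>" using assms(1) by (cases "cost ts v") auto
  then have pos: "\<forall>\<delta>\<in>set T. 0 < v \<bullet> real_vec \<delta>"
    using inner_pos_if_cost_finite assms(2) by blast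
  then obtain c where c: "term_cost v T = ereal c" "1 \<le> c"
      "(\<Sum>\<delta>\<leftarrow>T. c powr - (v \<bullet> real_vec \<delta>)) = 1"
    using term_cost_finite assms by metis
  have "ereal c \<le> ereal b"
    using term_cost_le_cost[OF assms(2), of v] assms(1) c(1) by (metis order_trans)
  then have "(\<Sum>\<delta>\<leftarrow>T. b powr - (v \<bullet> real_vec \<delta>)) \<le> (\<Sum>\<delta>\<leftarrow>T. c powr - (v \<bullet> real_vec \<delta>))"
    using pos c by (intro sum_list_mono powr_mono2') auto
  then show ?thesis using c by simp
qed

lemma real_vec_zero [simp]: "real_vec 0 = 0"
  by (simp add: real_vec_def vec_eq_iff)

lemma real_vec_add: "real_vec (x + y) = real_vec x + real_vec y"
  by (simp add: real_vec_def vec_eq_iff)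

lemma real_vec_diff: "real_vec (x - y) = real_vec x - real_vec y"
  by (simp add: real_vec_def vec_eq_iff)

lemma real_vec_smult: "real_vec (k *s x) = real_of_int k *\<^sub>R real_vec x"
  by (simp add: real_vec_def vec_eq_iff)

text \<open>Contrapositively, a vector of negative weight is not generated, so \<open>F\<close>
  vanishes there. This anchors the induction in the main bound.\<close>

lemma inner_generated_nonneg:
  assumes "x \<in> generated ts" "\<And>T \<delta>. T \<in> set ts \<Longrightarrow> \<delta> \<in> set T \<Longrightarrow> 0 \<le> v \<bullet> real_vec \<delta>"
  shows "0 \<le> v \<bullet> real_vec x"
proof -
  obtain xs where "set xs \<subseteq> (\<Union>T\<in>set ts. set T)" "x = sum_list xs"
    using assms(1) by (auto simp: generated_def)
  then show ?thesis
  proof (induction xs arbitrary: x)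
    case (Cons a xs)
    then show ?case using assms(2) by (force simp: real_vec_add inner_add_right)
  qed simp
qed

lemma recurrence_bound:
  fixes ts :: "('d::finite) rec_term list"
  assumes ts: "ts \<noteq> []" "\<forall>T\<in>set ts. T \<noteq> []"
    and F: "solves_recurrence ts F"
    and b: "cost ts v \<le> ereal b"
  shows "real (F x) \<le> b powr (v \<bullet> real_vec x)"
proof -
  have "1 \<le> ereal b" using cost_ge_1[OF ts] b order_trans by blast
  then have b1: "1 \<le> b" by simp
  have "cost ts v < \<infinity>" using b by (cases "cost ts v") auto
  note pos = inner_pos_if_cost_finite[OF this]
  let ?D = "\<Union>T\<in>set ts. set T"
  \<comment> \<open>The weight of \<open>x\<close> is real, so it does not support induction
    directly. Each recursive call lowers it by at least the smallest weight \<open>e > 0\<close>,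
    which allows induction on a natural number \<open>n\<close> with weight below
    \<open>n * e\<close>.\<close>
  define e where "e = Min ((\<lambda>\<delta>. v \<bullet> real_vec \<delta>) ` ?D)"
  have "?D \<noteq> {}" using ts by (cases ts) auto
  then have e: "0 < e" using pos by (auto simp: e_def)
  have e_le: "e \<le> v \<bullet> real_vec \<delta>" if "T \<in> set ts" "\<delta> \<in> set T" for T \<delta>
    using that by (auto simp: e_def intro!: Min_le)
  have bound: "real (F x) \<le> b powr (v \<bullet> real_vec x)" if "v \<bullet> real_vec x < real n * e" for n x
    using that
  proof (induction n arbitrary: x)
    \<comment> \<open>Here the weight is negative, so \<open>x\<close> is neither 0 nor generated
      and \<open>F x = 0\<close>.\<close>
    case 0
    then have "x \<noteq> 0" "x \<notin> generated ts"
      using inner_generated_nonneg[of x ts v] pos by force+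
    then show ?case using F by (simp add: solves_recurrence_def)
  next
    case (Suc n)
    consider "x = 0" | "x \<noteq> 0" "x \<notin> generated ts" | "x \<noteq> 0" "x \<in> generated ts" by blast
    then show ?case
    proof cases
      case 3
      have "F x = Max ((\<lambda>T. \<Sum>\<delta>\<leftarrow>T. F (x - \<delta>)) ` set ts)"
        using F 3 by (simp add: solves_recurrence_def)
      \<comment> \<open>The maximum over the finite set of terms is attained, so it suffices to
        estimate the sum of a single term \<open>T\<close>.\<close>
      also have "\<dots> \<in> (\<lambda>T. \<Sum>\<delta>\<leftarrow>T. F (x - \<delta>)) ` set ts"
        using ts by (intro Max_in) auto
      finally obtain T where T: "T \<in> set ts" "F x = (\<Sum>\<delta>\<leftarrow>T. F (x - \<delta>))" by auto
      have "real (F x) = (\<Sum>\<delta>\<leftarrow>T. real (F (x - \<delta>)))"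
        unfolding T(2) by (induction T) auto
      also have "\<dots> \<le> (\<Sum>\<delta>\<leftarrow>T. b powr (v \<bullet> real_vec x) * b powr - (v \<bullet> real_vec \<delta>))"
      proof (intro sum_list_mono)
        fix \<delta> assume \<delta>: "\<delta> \<in> set T"
        have "v \<bullet> real_vec (x - \<delta>) < real n * e"
          using e_le[OF T(1) \<delta>] Suc.prems by (simp add: real_vec_diff inner_diff_right algebra_simps)
        from Suc.IH[OF this]
        show "real (F (x - \<delta>)) \<le> b powr (v \<bullet> real_vec x) * b powr - (v \<bullet> real_vec \<delta>)"
          by (simp add: real_vec_diff inner_diff_right flip: powr_add)
      qed
      also have "\<dots> = b powr (v \<bullet> real_vec x) * (\<Sum>\<delta>\<leftarrow>T. b powr - (v \<bullet> real_vec \<delta>))"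
        by (simp add: sum_list_const_mult)
      also have "\<dots> \<le> b powr (v \<bullet> real_vec x) * 1"
        using powr_neg_sum_list_le_1_if_cost_le[OF b T(1)] ts T(1)
        by (intro mult_left_mono) auto
      finally show ?thesis by simp
    \<comment> \<open>At \<open>x = 0\<close> the bound reads \<open>1 \<le> b powr 0\<close>. Since
      \<open>0 powr 0 = 0\<close> in Isabelle, this relies on \<open>b\<close> being nonzero.
      Outside the generated set \<open>F x = 0\<close>.\<close>
    qed (use F b1 in \<open>auto simp: solves_recurrence_def\<close>)
  qed
  obtain n where "v \<bullet> real_vec x < real n * e"
    using reals_Archimedean3[OF e] by blast
  then show ?thesis by (rule bound)
qed

theorem theorem1:
  fixes ts :: "('d::finite) rec_term list"
    and F :: "int ^ 'd \<Rightarrow> nat"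
    and t :: "int ^ 'd"
    and c :: ereal
    and w :: "real ^ 'd"
  assumes "ts \<noteq> []"
    and "\<forall>T\<in>set ts. T \<noteq> []"
    and "solves_recurrence ts F"
    and "optimal_solution ts t c w"
    and "c < \<infinity>"
  shows "(\<lambda>n::nat. real (F (int n *s t))) \<in> O(\<lambda>n. real_of_ereal c ^ n)"
proof -
  have c: "c = Inf {cost ts v |v. v \<bullet> real_vec t = 1}"
    using assms(4) by (simp add: optimal_solution_def)
  have "1 \<le> c"
    unfolding c using cost_ge_1[OF assms(1,2)] by (intro Inf_greatest) auto
  then obtain r where r: "c = ereal r" "1 \<le> r"
    using assms(5) by (cases c) auto
  have "real (F (int n *s t)) \<le> r ^ n" for n
  \<comment> \<open>No \<open>v\<close> need have cost exactly \<open>r\<close>. The bound is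
    therefore shown for every \<open>b > r\<close>, and then \<open>b\<close> tends to
    \<open>r\<close> from the right with \<open>n\<close> fixed.\<close>
  proof (rule tendsto_lowerbound)
    show "((\<lambda>b. b ^ n) \<longlongrightarrow> r ^ n) (at_right r)"
      by (intro tendsto_intros)
    have "real (F (int n *s t)) \<le> b ^ n" if "r < b" for b
    proof -
      have "Inf {cost ts v |v. v \<bullet> real_vec t = 1} < ereal b"
        using that r c by simp
      then obtain v where v: "v \<bullet> real_vec t = 1" "cost ts v < ereal b"
        unfolding Inf_less_iff by blast
      have "real (F (int n *s t)) \<le> b powr (v \<bullet> real_vec (int n *s t))"
        using v by (intro recurrence_bound[OF assms(1-3)]) simp
      then show ?thesis
        \<comment> \<open>The exponent is \<open>n\<close>, because \<open>v\<close> has inner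
          product 1 with \<open>t\<close>, and \<open>b > r \<ge> 1\<close> lets \<open>powr\<close>
          become an ordinary power.\<close>
        using v that r by (simp add: real_vec_smult powr_realpow)
    qed
    then show "\<forall>\<^sub>F b in at_right r. real (F (int n *s t)) \<le> b ^ n"
      \<comment> \<open>The bound holds for all \<open>b > r\<close>, so \<open>r + 1\<close> is an
        arbitrary right end of the neighbourhood.\<close>
      by (auto simp: eventually_at_right_field intro!: exI[of _ "r + 1"])
  qed simp
  then show ?thesis
    using r by (intro bigoI[of _ 1]) simp
qed

end
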